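(* For $d \in [0,1]$ define $\lambda_d : \mathbb{R} \to \mathbb{R}$ by $\lambda_d(x) = e^{-x}$ if $x > 0$, $\lambda_d(0) = d$, and $\lambda_d(x) = 0$ if $x < 0$. (i) A Pólya frequency function is discontinuous if and only if, up to changes in scale and origin, it equals $\lambda_d$ for some $d \in [0,1]$. (ii) Similarly, a totally non-negative function $\mathbb{R} \to \mathbb{R}$ is discontinuous if and only if, up to changes in scale and origin, it equals $x \mapsto e^{ax+b} \lambda_d(x)$ for some $d \in [0,1]$ and $a, b \in \mathbb{R}$.
   Context: A function $\Lambda : \mathbb{R} \to \mathbb{R}$ is totally non-negative ($\mathrm{TN}$) if for every $n \geq 1$ and all reals $x_1 < \cdots < x_n$, $y_1 < \cdots < y_n$ one has $\det(\Lambda(x_i - y_j))_{i,j=1}^n \geq 0$. A Pólya frequency function is a totally non-negative function that is Lebesgue integrable and non-zero at two or more points. A function $f$ equals a function $g$ "up to changes in scale and origin" if $f(x) = C g(ux + v)$ for all $x \in \mathbb{R}$, for some constants $C > 0$, $u \in \mathbb{R} \setminus \{0\}$ and $v \in \mathbb{R}$ (so reflections are included).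
   Formalization: In (ii) the totally non-negative function is also assumed Lebesgue measurable and non-zero at two or more points; without this (ii) fails, e.g. for the indicator function of {0} or exp∘φ with φ a discontinuous additive function. *)

theory Defs
  imports "HOL-Analysis.Analysis" "Jordan_Normal_Form.Determinant"
begin

text \<open>
  HOL-Analysis and Jordan_Normal_Form both provide a constant called \<open>det\<close>; the qualified
  one below is for matrices of variable size \<open>n\<close>. The points with index
  \<open>i \<ge> n\<close> play no role.
\<close>

definition totally_nonneg :: "(real \<Rightarrow> real) \<Rightarrow> bool" where
  "totally_nonneg \<Lambda> \<longleftrightarrow>
     (\<forall>n\<ge>1. \<forall>x y :: nat \<Rightarrow> real.
        strict_mono_on {..<n} x \<longrightarrow> strict_mono_on {..<n} y \<longrightarrow>
        0 \<le> Determinant.det (Matrix.mat n n (\<lambda>(i, j). \<Lambda> (x i - y j))))"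

text \<open>
  No measurability and no lower bound on the support is built into \<open>totally_nonneg\<close>: the
  indicator function of a single point satisfies it, and so does \<open>exp \<circ> \<phi>\<close> for every
  additive \<open>\<phi>\<close>, measurable or not. Results on non-integrable totally non-negative functions
  therefore need measurability and the next condition as separate hypotheses.
\<close>

definition nonzero_at_two_points :: "(real \<Rightarrow> real) \<Rightarrow> bool" where
  "nonzero_at_two_points \<Lambda> \<longleftrightarrow> (\<exists>p q. p \<noteq> q \<and> \<Lambda> p \<noteq> 0 \<and> \<Lambda> q \<noteq> 0)"

definition polya_frequency :: "(real \<Rightarrow> real) \<Rightarrow> bool" where
  "polya_frequency \<Lambda> \<longleftrightarrow>
     totally_nonneg \<Lambda> \<and> integrable lebesgue \<Lambda> \<and> nonzero_at_two_points \<Lambda>"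

definition equal_upto_scale_origin :: "(real \<Rightarrow> real) \<Rightarrow> (real \<Rightarrow> real) \<Rightarrow> bool" where
  "equal_upto_scale_origin f g \<longleftrightarrow>
     (\<exists>C u v. C > 0 \<and> u \<noteq> 0 \<and> (\<forall>x. f x = C * g (u * x + v)))"

definition lambda_d :: "real \<Rightarrow> real \<Rightarrow> real" where
  "lambda_d d x = (if x > 0 then exp (- x) else if x = 0 then d else 0)"

end

theory Submission
  imports Defs
begin

text \<open>
  Order 2 minors make a totally non-negative \<open>\<Lambda>\<close> log-concave, so its support is an interval and,
  being measurable, \<open>\<Lambda>\<close> is continuous in the interior. A discontinuity therefore sits at an end of
  the support; after a reflection and a shift, \<open>\<Lambda>\<close> vanishes on the negative reals and has a positive
  limit \<open>L\<close> from the right at 0. Log-concavity gives \<open>L \<Lambda>(a + c) \<le> \<Lambda>(a) \<Lambda>(c)\<close> in the limit.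
  The order 3 minors with \<open>x = (\<delta>, 3\<delta>, c)\<close> and \<open>y = (-a, 0, 2\<delta>)\<close> tend, as \<open>\<delta> \<rightarrow> 0\<close>, to the
  determinant with rows \<open>(\<Lambda>(a), L, 0)\<close>, \<open>(\<Lambda>(a), L, L)\<close>, \<open>(\<Lambda>(a + c), \<Lambda>(c), \<Lambda>(c))\<close>, which is
  \<open>L (L \<Lambda>(a + c) - \<Lambda>(a) \<Lambda>(c))\<close>; this gives the reverse inequality. Hence \<open>\<Lambda>/L\<close> is multiplicative on the positive reals.
\<close>

section \<open>Minors of order at most 3 and symmetries of totally non-negative functions\<close>

lemma det_mat_2:
  "Determinant.det (Matrix.mat 2 2 f) = f (0,0) * f (1,1) - f (0,1) * f (1,0)"
  for f :: "nat \<times> nat \<Rightarrow> 'a :: comm_ring_1"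
  by (subst laplace_expansion_row[of _ 2 0])
     (auto simp: numeral_2_eq_2 cofactor_def mat_delete_def det_single)

lemma det_mat_3:
  "Determinant.det (Matrix.mat 3 3 f) =
     f (0,0) * (f (1,1) * f (2,2) - f (1,2) * f (2,1))
   - f (0,1) * (f (1,0) * f (2,2) - f (1,2) * f (2,0))
   + f (0,2) * (f (1,0) * f (2,1) - f (1,1) * f (2,0))"
  for f :: "nat \<times> nat \<Rightarrow> 'a :: comm_ring_1"
proof -
  have del: "mat_delete (Matrix.mat 3 3 f) 0 j =
      Matrix.mat 2 2 (\<lambda>(i', j'). f (Suc i', if j' < j then j' else Suc j'))" for j
    by (rule eq_matI) (auto simp: mat_delete_def)
  have sum_3: "(\<Sum>j<3. g j) = g 0 + g 1 + g 2" for g :: "nat \<Rightarrow> 'a"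
    by (simp add: numeral_3_eq_3 numeral_2_eq_2)
  show ?thesis
    by (subst laplace_expansion_row[of _ 3 0])
       (simp_all add: sum_3 cofactor_def del det_mat_2 numeral_2_eq_2[symmetric] algebra_simps)
qed

lemma totally_nonneg_ge_0:
  assumes "totally_nonneg \<Lambda>"
  shows "0 \<le> \<Lambda> x"
proof -
  have "strict_mono_on {..<1::nat} (\<lambda>_. z)" for z :: real
    by (auto simp: strict_mono_on_def)
  then have "0 \<le> Determinant.det (Matrix.mat 1 1 (\<lambda>(i, j). \<Lambda> (x - 0)))"
    using assms unfolding totally_nonneg_def by blast
  then show ?thesis
    by (simp add: det_single)
qed

text \<open>This is the minor with rows \<open>a + h\<close>, \<open>b\<close> and columns
  \<open>0\<close>, \<open>h\<close>. The multiplicative form avoids logarithms, so zeros of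
  \<open>\<Lambda>\<close> are covered.\<close>

lemma totally_nonneg_log_concave:
  assumes "totally_nonneg \<Lambda>" "0 < h" "h < b - a"
  shows "\<Lambda> a * \<Lambda> b \<le> \<Lambda> (a + h) * \<Lambda> (b - h)"
proof -
  define x y :: "nat \<Rightarrow> real"
    where "x = (\<lambda>i. if i = 0 then a + h else b)" and "y = (\<lambda>i. if i = 0 then 0 else h)"
  have "strict_mono_on {..<2} x" "strict_mono_on {..<2} y"
    using assms by (auto simp: strict_mono_on_def x_def y_def)
  then have "0 \<le> Determinant.det (Matrix.mat 2 2 (\<lambda>(i, j). \<Lambda> (x i - y j)))"
    using assms(1) unfolding totally_nonneg_def by (metis one_le_numeral)
  then show ?thesis
    by (simp add: det_mat_2 x_def y_def algebra_simps)
qed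

text \<open>Passing to \<open>v - x\<close> exchanges the roles of the points \<open>x i\<close> and
  \<open>y j\<close>, which transposes the matrix; adding \<open>v\<close> keeps a sequence
  increasing. Two reflections make a translation.\<close>

lemma totally_nonneg_reflect:
  assumes "totally_nonneg \<Lambda>"
  shows "totally_nonneg (\<lambda>x. \<Lambda> (v - x))"
  unfolding totally_nonneg_def
proof (intro allI impI)
  fix n :: nat and x y :: "nat \<Rightarrow> real"
  assume *: "1 \<le> n" "strict_mono_on {..<n} x" "strict_mono_on {..<n} y"
  then have "strict_mono_on {..<n} (\<lambda>i. v + y i)"
    by (simp add: strict_mono_on_def)
  then have "0 \<le> Determinant.det (Matrix.mat n n (\<lambda>(i, j). \<Lambda> (v + y i - x j)))"
    using assms * unfolding totally_nonneg_def by blast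
  also have "Matrix.mat n n (\<lambda>(i, j). \<Lambda> (v + y i - x j)) =
      transpose_mat (Matrix.mat n n (\<lambda>(i, j). \<Lambda> (v - (x i - y j))))"
    by (rule eq_matI) (auto simp: algebra_simps)
  finally show "0 \<le> Determinant.det (Matrix.mat n n (\<lambda>(i, j). \<Lambda> (v - (x i - y j))))"
    by (simp add: det_transpose[of _ n])
qed

lemma totally_nonneg_translate:
  assumes "totally_nonneg \<Lambda>"
  shows "totally_nonneg (\<lambda>x. \<Lambda> (v + x))"
  using totally_nonneg_reflect[OF totally_nonneg_reflect[OF assms, of v], of 0] by simp

text \<open>The corner entry has argument \<open>\<delta> - 2 * \<delta> < 0\<close> and vanishes,
  so the expansion along the first row has two terms. All other arguments are positive, so the limit
  involves the right-hand limit at 0 and never \<open>\<Lambda> 0\<close>.\<close>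

lemma totally_nonneg_order_3:
  assumes "totally_nonneg \<Lambda>" and zero: "\<And>x. x < 0 \<Longrightarrow> \<Lambda> x = 0"
    and "0 < a" "0 < \<delta>" "3 * \<delta> < c"
  shows "\<Lambda> (a + \<delta>) * (\<Lambda> (3 * \<delta>) * \<Lambda> (c - 2 * \<delta>) - \<Lambda> \<delta> * \<Lambda> c)
       \<ge> \<Lambda> \<delta> * (\<Lambda> (a + 3 * \<delta>) * \<Lambda> (c - 2 * \<delta>) - \<Lambda> \<delta> * \<Lambda> (a + c))"
proof -
  define x y :: "nat \<Rightarrow> real"
    where "x = (\<lambda>i. if i = 0 then \<delta> else if i = 1 then 3 * \<delta> else c)"
      and "y = (\<lambda>i. if i = 0 then -a else if i = 1 then 0 else 2 * \<delta>)"
  have "strict_mono_on {..<3} x" "strict_mono_on {..<3} y"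
    using assms by (auto simp: strict_mono_on_def x_def y_def)
  then have "0 \<le> Determinant.det (Matrix.mat 3 3 (\<lambda>(i, j). \<Lambda> (x i - y j)))"
    using assms(1) unfolding totally_nonneg_def by (metis one_le_numeral)
  then show ?thesis
    using zero[of "- \<delta>"] \<open>0 < \<delta>\<close> by (simp add: det_mat_3 x_def y_def algebra_simps)
qed

section \<open>Continuity of measurable log-concave functions\<close>

text \<open>If \<open>f m\<close> is small, then so is \<open>f (m - t)\<close> or \<open>f (m + t)\<close> for every \<open>t\<close>: arbitrarily small
  values would force the decreasing sublevel sets to have measure at least \<open>r\<close>, although they
  have empty intersection.\<close>

lemma log_concave_bounded_below:
  fixes f :: "real \<Rightarrow> real"
  assumes meas: "f \<in> borel_measurable lebesgue" and "0 < r"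
    and pos: "\<And>x. x \<in> {x0 - 2 * r..x0 + 2 * r} \<Longrightarrow> 0 < f x"
    and mid: "\<And>m t. 0 < t \<Longrightarrow> f (m - t) * f (m + t) \<le> f m * f m"
  shows "\<exists>c>0. \<forall>x\<in>{x0 - r..x0 + r}. c \<le> f x"
proof (rule ccontr)
  assume contra: "\<not> ?thesis"
  define S where "S = (\<lambda>n. {x \<in> {x0 - 2 * r..x0 + 2 * r}. f x \<le> 1 / real (Suc n)})"
  have sets_S: "S n \<in> sets lebesgue" for n
  proof -
    have "{x \<in> space lebesgue. f x \<le> 1 / real (Suc n)} \<in> sets lebesgue"
      using meas by (rule borel_measurable_le) simp
    moreover have "S n = {x0 - 2 * r..x0 + 2 * r} \<inter> {x \<in> space lebesgue. f x \<le> 1 / real (Suc n)}"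
      by (auto simp: S_def)
    ultimately show ?thesis by auto
  qed
  have lm_S: "S n \<in> lmeasurable" for n
    by (rule fmeasurableI2[of "{x0 - 2 * r..x0 + 2 * r}", OF _ _ sets_S]) (auto simp: S_def)
  have big: "r \<le> measure lebesgue (S n)" for n
  proof -
    obtain m where m: "m \<in> {x0 - r..x0 + r}" "f m < 1 / real (Suc n)"
    proof -
      have "0 < 1 / real (Suc n)" by simp
      with contra that show ?thesis by (meson not_le)
    qed
    \<comment> \<open>The reflection of \<open>S n\<close> in \<open>m\<close>; it has the same
      measure as \<open>S n\<close>.\<close>
    define R where "R = (\<lambda>x. 2 * m + (-1) *\<^sub>R x) ` S n"
    have "((*\<^sub>R) (-1 :: real)) -` S n \<inter> space lebesgue \<in> sets lebesgue"
      using lebesgue_measurable_scaling sets_S by (rule measurable_sets)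
    moreover have "R = (+) (2 * m) ` (((*\<^sub>R) (-1 :: real)) -` S n \<inter> space lebesgue)"
      unfolding R_def by (force simp: image_iff)
    ultimately have "R \<in> sets lebesgue"
      using lebesgue_sets_translation by metis
    moreover have "emeasure lebesgue R = emeasure lebesgue (S n)"
      unfolding R_def using emeasure_lebesgue_affine[of "-1" "2 * m" "S n"] by simp
    ultimately have R: "R \<in> lmeasurable" "measure lebesgue R = measure lebesgue (S n)"
      using lm_S[of n] by (auto simp: fmeasurable_def measure_def)
    \<comment> \<open>Since \<open>m\<close> is within \<open>r\<close> of \<open>x0\<close>, both
      \<open>x\<close> and \<open>2 * m - x\<close> stay in the large interval. If both lay outside
      \<open>S n\<close>, then \<open>f x * f (2 * m - x)\<close> would exceed
      \<open>f m * f m\<close>. So two sets of equal measure cover an interval of length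
      \<open>2 * r\<close>.\<close>
    have "{m - r..m + r} \<subseteq> S n \<union> R"
    proof
      fix x assume x: "x \<in> {m - r..m + r}"
      show "x \<in> S n \<union> R"
      proof (rule ccontr)
        assume "x \<notin> S n \<union> R"
        moreover have "x \<in> R" if "2 * m - x \<in> S n"
          unfolding R_def by (rule image_eqI[OF _ that]) simp
        ultimately have "x \<notin> S n" "2 * m - x \<notin> S n" by auto
        moreover have "x \<in> {x0 - 2 * r..x0 + 2 * r}" "2 * m - x \<in> {x0 - 2 * r..x0 + 2 * r}"
          using x m by auto
        ultimately have fx: "1 / real (Suc n) < f x" "1 / real (Suc n) < f (2 * m - x)"
          by (auto simp: S_def)
        then have "x \<noteq> m" using m by auto
        have "f x * f (2 * m - x) \<le> f m * f m"
        proof (cases "x < m")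
          case True
          then show ?thesis using mid[of "m - x" m] by (simp add: algebra_simps)
        next
          case False
          then show ?thesis using mid[of "x - m" m] \<open>x \<noteq> m\<close> by (simp add: algebra_simps)
        qed
        moreover have "0 < f m" using m \<open>0 < r\<close> by (intro pos) auto
        moreover have "f m * f m < f x * f (2 * m - x)"
          using fx m \<open>0 < f m\<close> by (intro mult_strict_mono) auto
        ultimately show False by simp
      qed
    qed
    then have "measure lebesgue {m - r..m + r} \<le> measure lebesgue (S n \<union> R)"
      using lm_S R by (intro measure_mono_fmeasurable) auto
    also have "\<dots> \<le> measure lebesgue (S n) + measure lebesgue R"
      using lm_S R by (intro measure_Un_le) auto
    finally show ?thesis using R \<open>0 < r\<close> by simp
  qed
  have "(\<lambda>n. measure lebesgue (S n)) \<longlonglongrightarrow> measure lebesgue (\<Inter>n. S n)"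
  proof (rule Lim_measure_decseq)
    show "range S \<subseteq> sets lebesgue" using sets_S by auto
    have "1 / real (Suc n) \<le> 1 / real (Suc m)" if "m \<le> n" for m n
      using that by (simp add: frac_le)
    then show "decseq S"
      unfolding decseq_def S_def using order_trans by fastforce
    show "emeasure lebesgue (S n) \<noteq> \<infinity>" for n
      using lm_S[of n] by (auto simp: fmeasurable_def)
  qed
  moreover have "(\<Inter>n. S n) = {}"
  proof -
    have "x \<notin> (\<Inter>n. S n)" if "x \<in> {x0 - 2 * r..x0 + 2 * r}" for x
      using pos[OF that] nat_approx_posE[of "f x"] by (auto simp: S_def not_le)
    then show ?thesis by (auto simp: S_def)
  qed
  ultimately have "(\<lambda>n. measure lebesgue (S n)) \<longlonglongrightarrow> 0" by simp
  then have "r \<le> 0"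
    by (rule LIMSEQ_le_const) (use big in auto)
  with \<open>0 < r\<close> show False by simp
qed

text \<open>Increments of a concave function over intervals of a fixed length decrease, so \<open>n\<close> equal
  steps to the right and to the left of \<open>{x..x + h}\<close> bracket the increment over \<open>{x..x + h}\<close>.\<close>

lemma concave_increment_bound:
  fixes g :: "real \<Rightarrow> real"
  assumes "0 < h" "0 < n" "real n * h < r" "dist x x0 < r" "dist (x + h) x0 < r"
    and bd: "\<And>x. x \<in> {x0 - 2 * r..x0 + 2 * r} \<Longrightarrow> \<bar>g x\<bar> \<le> K"
    and conc: "\<And>a b h. x0 - 2 * r \<le> a \<Longrightarrow> b \<le> x0 + 2 * r \<Longrightarrow> 0 < h \<Longrightarrow> h < b - a \<Longrightarrow>
      g a + g b \<le> g (a + h) + g (b - h)"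
  shows "\<bar>g (x + h) - g x\<bar> \<le> 2 * K / n"
proof -
  define D where "D = g (x + h) - g x"
  have r: "x0 - r < x" "x + h < x0 + r"
    using assms by (auto simp: dist_real_def)
  have step: "real k * h \<le> real n * h" if "k \<le> n" for k
    using that \<open>0 < h\<close> by simp
  have up: "g (x + real k * h) - g x \<le> real k * D" if "k \<le> n" for k
    using that
  proof (induction k)
    case (Suc k)
    have "real (Suc k) * h < r" using step[OF Suc.prems] assms(3) by linarith
    \<comment> \<open>\<open>conc\<close> needs \<open>h < b - a\<close>, that is
      \<open>k \<ge> 1\<close>; for \<open>k = 0\<close> the two increments coincide.\<close>
    then have "g x + g (x + real (Suc k) * h) \<le> g (x + h) + g (x + real (Suc k) * h - h)" if "k \<noteq> 0"
      using that r assms(1) by (intro conc) (auto simp: algebra_simps)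
    then have "g (x + real (Suc k) * h) - g (x + real k * h) \<le> D"
      by (cases "k = 0") (simp_all add: D_def algebra_simps)
    with Suc show ?case by (simp add: algebra_simps)
  qed simp
  have down: "real k * D \<le> g (x + h) - g (x + h - real k * h)" if "k \<le> n" for k
    using that
  proof (induction k)
    case (Suc k)
    have "real (Suc k) * h < r" using step[OF Suc.prems] assms(3) by linarith
    then have "g (x + h - real (Suc k) * h) + g (x + h)
        \<le> g (x + h - real (Suc k) * h + h) + g (x + h - h)" if "k \<noteq> 0"
      using that r assms(1) by (intro conc) (auto simp: algebra_simps)
    then have "D \<le> g (x + h - real k * h) - g (x + h - real (Suc k) * h)"
      by (cases "k = 0") (simp_all add: D_def algebra_simps)
    with Suc show ?case by (simp add: algebra_simps)
  qed simp
  have nh: "0 < real n * h"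
    using assms by simp
  have "\<bar>g x\<bar> \<le> K" "\<bar>g (x + h)\<bar> \<le> K" "\<bar>g (x + real n * h)\<bar> \<le> K" "\<bar>g (x + h - real n * h)\<bar> \<le> K"
    by (intro bd; use r assms(1-3) nh in \<open>unfold atLeastAtMost_iff, linarith\<close>)+
  \<comment> \<open>Each of the two bracketing differences of values of \<open>g\<close> is at most
    \<open>2 * K\<close> in absolute value.\<close>
  with up[of n] down[of n] have "\<bar>real n * D\<bar> \<le> 2 * K" by linarith
  then have "real n * \<bar>D\<bar> \<le> 2 * K"
    by (simp add: abs_mult)
  then show ?thesis
    using \<open>0 < n\<close> unfolding D_def[symmetric] by (simp add: field_simps)
qed

text \<open>Measurability gives a positive lower bound for \<open>f\<close> near \<open>x0\<close>,
  and reflection in \<open>x0\<close> turns it into an upper bound. So \<open>ln f\<close> is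
  bounded and concave near \<open>x0\<close>, and its increments over short intervals are small. The
  radius shrinks from \<open>4 * r\<close> to \<open>2 * r\<close> for the bounds, then to
  \<open>r\<close> for the points compared.\<close>

lemma log_concave_continuous:
  fixes f :: "real \<Rightarrow> real"
  assumes meas: "f \<in> borel_measurable lebesgue" and "0 < r"
    and pos: "\<And>x. x \<in> {x0 - 4 * r..x0 + 4 * r} \<Longrightarrow> 0 < f x"
    and conc: "\<And>a b h. 0 < h \<Longrightarrow> h < b - a \<Longrightarrow> f a * f b \<le> f (a + h) * f (b - h)"
  shows "isCont f x0"
proof -
  have mid: "f (m - t) * f (m + t) \<le> f m * f m" if "0 < t" for m t
    using conc[of t "m + t" "m - t"] that by simp
  obtain c where c: "0 < c" "\<And>x. x \<in> {x0 - 2 * r..x0 + 2 * r} \<Longrightarrow> c \<le> f x"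
    using log_concave_bounded_below[OF meas, of "2 * r" x0] pos mid \<open>0 < r\<close> by auto
  \<comment> \<open>The maximum covers \<open>x = x0\<close>, where \<open>mid\<close> with its
    \<open>0 < t\<close> says nothing.\<close>
  define B where "B = max (f x0) (f x0 * f x0 / c)"
  have B: "f x \<le> B" if "x \<in> {x0 - 2 * r..x0 + 2 * r}" for x
  proof (cases "x = x0")
    case False
    have "f x * f (2 * x0 - x) \<le> f x0 * f x0"
      using mid[of "x - x0" x0] mid[of "x0 - x" x0] False
      by (cases "x < x0") (auto simp: algebra_simps)
    moreover have "f x * c \<le> f x * f (2 * x0 - x)"
      using c(2)[of x] c(2)[of "2 * x0 - x"] c(1) that by (intro mult_left_mono) auto
    ultimately show ?thesis
      using c(1) by (simp add: B_def le_max_iff_disj pos_le_divide_eq)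
  qed (simp add: B_def)
  define K where "K = max \<bar>ln c\<bar> \<bar>ln B\<bar>"
  define g where "g = (\<lambda>x. ln (f x))"
  have f_pos: "0 < f x" if "x \<in> {x0 - 2 * r..x0 + 2 * r}" for x
    using c(1) c(2)[OF that] by linarith
  have K: "\<bar>g x\<bar> \<le> K" if "x \<in> {x0 - 2 * r..x0 + 2 * r}" for x
  proof -
    have "ln c \<le> g x" "g x \<le> ln B"
      using c(1) c(2)[OF that] B[OF that] f_pos[OF that] by (auto simp: g_def)
    then show ?thesis by (auto simp: K_def)
  qed
  have g_conc: "g a + g b \<le> g (a + h) + g (b - h)"
    if "x0 - 2 * r \<le> a" "b \<le> x0 + 2 * r" "0 < h" "h < b - a" for a b h
  proof -
    have "0 < f a" "0 < f b" "0 < f (a + h)" "0 < f (b - h)"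
      using that by (auto intro!: f_pos)
    moreover from this have "ln (f a * f b) \<le> ln (f (a + h) * f (b - h))"
      using conc[OF that(3,4)] by simp
    ultimately show ?thesis by (simp add: g_def ln_mult)
  qed
  have "isCont g x0"
    unfolding continuous_at_eps_delta
  proof (intro allI impI)
    fix e :: real assume "0 < e"
    obtain n where "2 * K / e < real n" using reals_Archimedean2 by blast
    moreover have "0 \<le> K" by (simp add: K_def)
    ultimately have "0 < n"
      using \<open>0 < e\<close> by (intro gr0I) (simp add: field_simps)
    with \<open>2 * K / e < real n\<close> have n: "0 < n" "2 * K / real n < e"
      using \<open>0 < e\<close> by (simp_all add: field_simps)
    \<comment> \<open>The radius \<open>r / (n + 1)\<close> ensures both
      \<open>n * \<bar>x - x0\<bar> < r\<close>, so that \<open>n\<close> steps fit, and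
      \<open>\<bar>x - x0\<bar> < r\<close>.\<close>
    have "dist (g x) (g x0) < e" if "dist x x0 < r / (real n + 1)" for x
    proof -
      have rn: "r / (real n + 1) \<le> r" using \<open>0 < r\<close> by (simp add: field_simps)
      have "real n * dist x x0 \<le> (real n + 1) * dist x x0" by (simp add: algebra_simps)
      also have "\<dots> < r" using that by (simp add: field_simps)
      finally have h: "real n * \<bar>x - x0\<bar> < r" by (simp add: dist_real_def)
      consider "x = x0" | "x0 < x" | "x < x0" by linarith
      then show ?thesis
      proof cases
        case 2
        have "\<bar>g (x0 + (x - x0)) - g x0\<bar> \<le> 2 * K / real n"
          using 2 n h that rn \<open>0 < r\<close> K g_conc
          by (intro concave_increment_bound[where r = r and ?x0.0 = x0]) auto
        with n show ?thesis by (simp add: dist_real_def)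
      next
        case 3
        have "\<bar>g (x + (x0 - x)) - g x\<bar> \<le> 2 * K / real n"
          using 3 n h that rn \<open>0 < r\<close> K g_conc
          by (intro concave_increment_bound[where r = r and ?x0.0 = x0]) auto
        with n show ?thesis by (simp add: dist_real_def)
      qed (use \<open>0 < e\<close> in simp)
    qed
    then show "\<exists>d>0. \<forall>x. dist x x0 < d \<longrightarrow> dist (g x) (g x0) < e"
      using \<open>0 < r\<close> by (intro exI[of _ "r / (real n + 1)"]) auto
  qed
  then have "isCont (\<lambda>x. exp (g x)) x0" by simp
  moreover have "\<forall>\<^sub>F x in nhds x0. exp (g x) = f x"
  proof -
    have "\<forall>\<^sub>F x in nhds x0. x \<in> {x0 - 2 * r<..<x0 + 2 * r}"
      using \<open>0 < r\<close> by (intro eventually_nhds_in_open) auto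
    then show ?thesis
      by eventually_elim (use f_pos in \<open>simp add: g_def less_imp_le\<close>)
  qed
  ultimately show ?thesis by (simp add: isCont_cong)
qed

section \<open>The additive functional equation and limits at the end of the support\<close>

text \<open>Subtracting the linear part leaves an additive \<open>e\<close> with
  \<open>e 1 = 0\<close>. It is 1-periodic on the positive reals, hence bounded by its bound on
  \<open>{1..2}\<close>, and \<open>e (n * x) = n * e x\<close> then forces
  \<open>e x = 0\<close>.\<close>

lemma additive_on_pos_linear:
  fixes g :: "real \<Rightarrow> real"
  assumes add: "\<And>x y. 0 < x \<Longrightarrow> 0 < y \<Longrightarrow> g (x + y) = g x + g y"
    and cont: "continuous_on {1..2} g" and "0 < x"
  shows "g x = x * g 1"
proof -
  define e where "e = (\<lambda>x. g x - x * g 1)"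
  have e_add: "e (x + y) = e x + e y" if "0 < x" "0 < y" for x y
    using add[OF that] by (simp add: e_def algebra_simps)
  have e_1: "e 1 = 0" by (simp add: e_def)
  have e_nat: "e (real n + y) = e y" if "0 < y" for n y
  proof (induction n)
    case (Suc n)
    have "e (real (Suc n) + y) = e (1 + (real n + y))" by (simp add: algebra_simps)
    also have "\<dots> = e 1 + e (real n + y)" using that by (intro e_add) auto
    finally show ?case using Suc e_1 by simp
  qed simp
  have e_mult: "e (real (Suc n) * x) = real (Suc n) * e x" for n
  proof (induction n)
    case (Suc n)
    have "e (real (Suc (Suc n)) * x) = e (real (Suc n) * x + x)" by (simp add: algebra_simps)
    also have "\<dots> = e (real (Suc n) * x) + e x" using \<open>0 < x\<close> by (intro e_add) auto
    finally show ?case using Suc by (simp add: algebra_simps)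
  qed simp
  have "continuous_on {1..2} e"
    unfolding e_def using cont by (intro continuous_intros) auto
  then have "bounded (e ` {1..2})"
    by (intro compact_imp_bounded compact_continuous_image) auto
  then obtain B where B: "\<And>y. y \<in> {1..2} \<Longrightarrow> \<bar>e y\<bar> \<le> B"
    by (metis bounded_iff imageI real_norm_def)
  have bound: "real (Suc n) * \<bar>e x\<bar> \<le> B" for n
  proof -
    define z where "z = real (Suc n) * x"
    have "0 < z" using \<open>0 < x\<close> by (simp add: z_def)
    \<comment> \<open>The extra 1 keeps the argument positive when \<open>frac z = 0\<close> and
      puts it in \<open>{1..2}\<close>.\<close>
    have z: "real 1 + z = real (nat \<lfloor>z\<rfloor>) + (1 + frac z)"
      using \<open>0 < z\<close> by (simp add: frac_def)
    have "e z = e (real 1 + z)" by (rule e_nat[OF \<open>0 < z\<close>, symmetric])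
    also have "\<dots> = e (1 + frac z)"
      unfolding z by (rule e_nat) (simp add: add_pos_nonneg)
    finally have "\<bar>e z\<bar> \<le> B"
      using B[of "1 + frac z"] frac_lt_1[of z] by simp
    then show ?thesis
      unfolding z_def e_mult by (simp add: abs_mult)
  qed
  have "e x = 0"
  proof (rule ccontr)
    assume "e x \<noteq> 0"
    then obtain n where "B < real n * \<bar>e x\<bar>"
      using reals_Archimedean3 by (metis zero_less_abs_iff)
    also have "\<dots> \<le> real (Suc n) * \<bar>e x\<bar>"
      by (intro mult_right_mono) auto
    finally show False using bound[of n] by simp
  qed
  then show ?thesis by (simp add: e_def)
qed

text \<open>Boundedness near 0 gives a limit \<open>L\<close> along some sequence \<open>Y\<close>.
  Log-concavity then compares \<open>f y\<close> with \<open>f (Y n)\<close> in both orders: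
  \<open>Y n < y\<close> bounds \<open>f y\<close> from below, \<open>y < Y n\<close> from above,
  and both bounds come arbitrarily close to \<open>L\<close>.\<close>

lemma log_concave_right_limit:
  fixes f :: "real \<Rightarrow> real"
  assumes conc: "\<And>a b h. 0 < h \<Longrightarrow> h < b - a \<Longrightarrow> f a * f b \<le> f (a + h) * f (b - h)"
    and "0 < q" and pos: "\<And>x. 0 < x \<Longrightarrow> x < q \<Longrightarrow> 0 < f x"
    and cont: "\<And>x. 0 < x \<Longrightarrow> x < q \<Longrightarrow> isCont f x"
  obtains L where "(f \<longlongrightarrow> L) (at_right 0)"
proof -
  define b where "b = q / 2"
  have b: "0 < b" "b < q" "0 < f b" "isCont f b"
    using \<open>0 < q\<close> pos cont by (auto simp: b_def)
  \<comment> \<open>The pair \<open>x\<close>, \<open>b\<close> is moved inward by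
    \<open>y - x\<close>; the factor near \<open>b\<close> is controlled by continuity
    there.\<close>
  have shift: "f x * f b \<le> f y * f (b - y + x)" if "0 < x" "x < y" "y < b" for x y
    using conc[of "y - x" b x] that by (simp add: algebra_simps)
  have "continuous_on {b / 2..b} f"
    using b cont by (intro continuous_at_imp_continuous_on) auto
  then have "bounded (f ` {b / 2..b})"
    by (intro compact_imp_bounded compact_continuous_image) auto
  then obtain M where M: "\<And>x. x \<in> {b / 2..b} \<Longrightarrow> \<bar>f x\<bar> \<le> M"
    by (metis bounded_iff imageI real_norm_def)
  define X where "X = (\<lambda>n. b / 4 / real (Suc n))"
  have X: "0 < X n" "X n \<le> b / 4" for n
    using b by (auto simp: X_def field_simps)
  have X_lim: "X \<longlonglongrightarrow> 0"
    unfolding X_def by (intro LIMSEQ_Suc[OF lim_const_over_n])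
  have "norm (f (X n)) \<le> f (b / 2) * M / f b" for n
  proof -
    have "f (X n) * f b \<le> f (b / 2) * f (b - b / 2 + X n)"
      using X[of n] b by (intro shift) auto
    also have "\<dots> \<le> f (b / 2) * M"
      using X[of n] b pos[of "b / 2"] M[of "b - b / 2 + X n"] by (intro mult_left_mono) auto
    finally show ?thesis
      using b X[of n] pos[of "X n"] by (simp add: field_simps)
  qed
  then have "bounded (range (f \<circ> X))"
    by (auto simp: bounded_iff)
  then obtain L r where r: "strict_mono r" and L: "((f \<circ> X) \<circ> r) \<longlonglongrightarrow> L"
    using bounded_imp_convergent_subsequence by blast
  define Y where "Y = X \<circ> r"
  have Y: "0 < Y n" "Y n < b" for n
    using X[of "r n"] b(1) by (auto simp: Y_def)
  have Y_lim: "Y \<longlonglongrightarrow> 0"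
    unfolding Y_def using X_lim r by (rule LIMSEQ_subseq_LIMSEQ)
  have fY: "(\<lambda>n. f (Y n)) \<longlonglongrightarrow> L"
    using L by (simp add: Y_def comp_def)
  have lower: "L * f b / f (b - y) \<le> f y" if y: "0 < y" "y < b" for y
  proof -
    have "isCont f (b - y)" using y b by (intro cont) auto
    moreover have "(\<lambda>n. b - y + Y n) \<longlonglongrightarrow> b - y"
      using tendsto_add[OF tendsto_const Y_lim] by simp
    ultimately have "(\<lambda>n. f y * f (b - y + Y n)) \<longlonglongrightarrow> f y * f (b - y)"
      by (intro tendsto_mult tendsto_const isCont_tendsto_compose[of _ f])
    moreover have "(\<lambda>n. f (Y n) * f b) \<longlonglongrightarrow> L * f b"
      using fY by (intro tendsto_mult tendsto_const)
    moreover have "\<forall>\<^sub>F n in sequentially. f (Y n) * f b \<le> f y * f (b - y + Y n)"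
      using order_tendstoD(2)[OF Y_lim y(1)] by eventually_elim (use Y y in \<open>auto intro: shift\<close>)
    ultimately have "L * f b \<le> f y * f (b - y)"
      by (intro tendsto_le[OF sequentially_bot])
    then show ?thesis
      using pos[of "b - y"] y b by (simp add: field_simps)
  qed
  have "(f \<longlongrightarrow> L) (at_right 0)"
  proof (rule order_tendstoI)
    fix a assume "a < L"
    have "((\<lambda>y. f (b - y)) \<longlongrightarrow> f b) (at_right 0)"
      by (rule isCont_tendsto_compose[OF b(4)]) (auto intro!: tendsto_eq_intros)
    then have "((\<lambda>y. L * f b / f (b - y)) \<longlongrightarrow> L * f b / f b) (at_right 0)"
      using b by (intro tendsto_intros) auto
    then have "\<forall>\<^sub>F y in at_right 0. a < L * f b / f (b - y)"
      using \<open>a < L\<close> b by (intro order_tendstoD) auto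
    moreover have "\<forall>\<^sub>F y in at_right 0. y \<in> {0<..<b}"
      using b by (intro eventually_at_right_real)
    ultimately show "\<forall>\<^sub>F y in at_right 0. a < f y"
      by eventually_elim (use lower in \<open>fastforce intro: less_le_trans\<close>)
  next
    fix a assume "L < a"
    \<comment> \<open>First \<open>n\<close> is fixed so that this bound is below \<open>a\<close>,
      and only then does \<open>y\<close> tend to 0.\<close>
    have "(\<lambda>n. f (Y n) * f (b - Y n) / f b) \<longlonglongrightarrow> L * f b / f b"
    proof (intro tendsto_intros fY)
      show "(\<lambda>n. f (b - Y n)) \<longlonglongrightarrow> f b"
        by (rule isCont_tendsto_compose[OF b(4)]) (use tendsto_diff[OF tendsto_const Y_lim] in simp)
    qed (use b in auto)
    then have "\<forall>\<^sub>F n in sequentially. f (Y n) * f (b - Y n) / f b < a"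
      using \<open>L < a\<close> b by (intro order_tendstoD) auto
    then obtain n where n: "f (Y n) * f (b - Y n) / f b < a"
      by (auto dest: eventually_happens)
    have "isCont f (b - Y n)" using Y[of n] b by (intro cont) auto
    then have "((\<lambda>y. f (b - Y n + y)) \<longlongrightarrow> f (b - Y n)) (at_right 0)"
      by (rule isCont_tendsto_compose) (auto intro!: tendsto_eq_intros)
    then have "((\<lambda>y. f (Y n) * f (b - Y n + y) / f b) \<longlongrightarrow> f (Y n) * f (b - Y n) / f b) (at_right 0)"
      using b by (intro tendsto_intros) auto
    then have "\<forall>\<^sub>F y in at_right 0. f (Y n) * f (b - Y n + y) / f b < a"
      using n by (rule order_tendstoD)
    moreover have "\<forall>\<^sub>F y in at_right 0. y \<in> {0<..<Y n}"
      using Y by (intro eventually_at_right_real)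
    ultimately show "\<forall>\<^sub>F y in at_right 0. f y < a"
    proof eventually_elim
      case (elim y)
      then have "f y * f b \<le> f (Y n) * f (b - Y n + y)"
        using Y[of n] by (intro shift) auto
      then have "f y \<le> f (Y n) * f (b - Y n + y) / f b"
        using b by (simp add: field_simps)
      with elim show ?case by simp
    qed
  qed
  then show ?thesis by (rule that)
qed

section \<open>Classification of the discontinuous functions\<close>

text \<open>The normalised case, with the discontinuity at 0 and the support to its right. Here
  \<open>L\<close> is the right-hand limit at 0, and \<open>d = f 0 / L\<close> lies in
  \<open>{0..1}\<close> because log-concavity gives \<open>f 0 \<le> L\<close>. The rate
  \<open>k\<close> may have either sign.\<close>

lemma one_sided_discontinuous_exp:
  fixes f :: "real \<Rightarrow> real"
  assumes tn: "totally_nonneg f" and zero: "\<And>x. x < 0 \<Longrightarrow> f x = 0"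
    and "0 < q" "0 < f q"
    and cont: "\<And>p x s. p < x \<Longrightarrow> x < s \<Longrightarrow> 0 < f p \<Longrightarrow> 0 < f s \<Longrightarrow> isCont f x"
    and ncont: "\<not> isCont f 0"
  obtains L k d where "0 < L" "d \<in> {0..1}"
    "\<And>x. f x = L * (if x > 0 then exp (k * x) else if x = 0 then d else 0)"
proof -
  have nonneg: "0 \<le> f x" for x
    using tn by (rule totally_nonneg_ge_0)
  have conc: "f a * f b \<le> f (a + h) * f (b - h)" if "0 < h" "h < b - a" for a b h
    using tn that by (rule totally_nonneg_log_concave)
  have between: "0 < f x" if "0 < f a" "0 < f b" "a < x" "x < b" for a b x
  proof -
    have "0 < f a * f b" using that by simp
    also have "\<dots> \<le> f x * f (b - (x - a))"
      using conc[of "x - a" b a] that by simp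
    finally have "f x \<noteq> 0" by auto
    then show ?thesis using nonneg[of x] by simp
  qed
  \<comment> \<open>A zero at \<open>x\<close> would force \<open>f\<close> to vanish on all of
    \<open>{..<x}\<close>, hence near 0, making it continuous there.\<close>
  have pos_below: "0 < f x" if "0 < x" "x < s" "0 < f s" for x s
  proof (rule ccontr)
    assume "\<not> 0 < f x"
    have "f z = 0" if "z < x" for z
      using between[of z s x] \<open>0 < f s\<close> \<open>x < s\<close> \<open>\<not> 0 < f x\<close> that nonneg[of z] by fastforce
    moreover have "\<forall>\<^sub>F z in nhds 0. z \<in> {..<x}"
      using \<open>0 < x\<close> by (intro eventually_nhds_in_open) auto
    ultimately have "\<forall>\<^sub>F z in nhds 0. f z = 0"
      by (auto elim: eventually_mono)
    then have "isCont f 0 \<longleftrightarrow> isCont (\<lambda>_. 0 :: real) (0 :: real)"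
      by (intro isCont_cong)
    with ncont show False by simp
  qed
  have cont_below: "isCont f x" if "0 < x" "x < s" "0 < f s" for x s
    using cont[of "x / 2" x s] pos_below[of "x / 2" s] that by simp
  obtain L where L: "(f \<longlongrightarrow> L) (at_right 0)"
    using log_concave_right_limit[of f q, OF conc \<open>0 < q\<close>] pos_below cont_below \<open>0 < f q\<close> by blast
  have right: "\<forall>\<^sub>F x in at_right 0. x \<in> {0<..<c}" if "0 < c" for c :: real
    using that by (rule eventually_at_right_real)
  have L_scale: "((\<lambda>\<delta>. f (t * \<delta>)) \<longlongrightarrow> L) (at_right 0)" if "0 < t" for t
  proof (rule filterlim_compose[OF L])
    show "filterlim (\<lambda>\<delta>. t * \<delta>) (at_right 0) (at_right 0)"
      using that unfolding filterlim_at
      by (auto intro!: tendsto_eq_intros always_eventually simp: eventually_at_filter)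
  qed
  have "0 \<le> L"
    using tendsto_lowerbound[OF L, of 0] nonneg by simp
  have f0: "f 0 \<le> L"
  proof -
    define b where "b = q / 2"
    have b: "0 < b" "0 < f b" "isCont f b"
      using pos_below[of b q] cont_below[of b q] \<open>0 < q\<close> \<open>0 < f q\<close> by (auto simp: b_def)
    have "((\<lambda>\<delta>. f (b - \<delta>)) \<longlongrightarrow> f b) (at_right 0)"
      by (rule isCont_tendsto_compose[OF b(3)]) (auto intro!: tendsto_eq_intros)
    then have "((\<lambda>\<delta>. f \<delta> * f (b - \<delta>)) \<longlongrightarrow> L * f b) (at_right 0)"
      by (intro tendsto_mult L)
    moreover have "\<forall>\<^sub>F \<delta> in at_right 0. f 0 * f b \<le> f \<delta> * f (b - \<delta>)"
      using right[OF b(1)] by eventually_elim (use conc[of _ b 0] in auto)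
    ultimately have "f 0 * f b \<le> L * f b"
      by (intro tendsto_lowerbound) auto
    then show ?thesis using b by simp
  qed
  have "L \<noteq> 0"
  proof
    assume "L = 0"
    then have "f 0 = 0" using f0 nonneg[of 0] by simp
    have "(f \<longlongrightarrow> 0) (at_left 0)"
      by (rule tendsto_eventually) (auto simp: eventually_at_filter zero intro!: always_eventually)
    then have "(f \<longlongrightarrow> f 0) (at 0)"
      using L \<open>L = 0\<close> \<open>f 0 = 0\<close> by (simp add: filterlim_split_at)
    with ncont show False by (simp add: isCont_def)
  qed
  with \<open>0 \<le> L\<close> have "0 < L" by simp
  \<comment> \<open>In the order 3 inequality the argument \<open>a + c\<close> does not depend on
    \<open>\<delta>\<close>, so continuity is asked only at \<open>a\<close> and
    \<open>c\<close>.\<close>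
  have super: "f a * f c \<le> L * f (a + c)"
    if "0 < a" "0 < c" "isCont f a" "isCont f c" for a c
  proof -
    have lim: "((\<lambda>\<delta>. f (z + t * \<delta>)) \<longlongrightarrow> f z) (at_right 0)" if "isCont f z" for z t
      by (rule isCont_tendsto_compose[OF that]) (auto intro!: tendsto_eq_intros)
    have "\<forall>\<^sub>F \<delta> in at_right 0. \<delta> \<in> {0<..<c / 3}"
      using \<open>0 < c\<close> by (intro right) simp
    \<comment> \<open>The coefficients \<open>1\<close> and \<open>-2\<close> are spelled out to
      match the patterns of \<open>L_scale\<close> and \<open>lim\<close>.\<close>
    then have "\<forall>\<^sub>F \<delta> in at_right 0. f (1 * \<delta>) * (f (a + 3 * \<delta>) * f (c + (-2) * \<delta>) - f (1 * \<delta>) * f (a + c))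
       \<le> f (a + 1 * \<delta>) * (f (3 * \<delta>) * f (c + (-2) * \<delta>) - f (1 * \<delta>) * f c)"
      by eventually_elim (use totally_nonneg_order_3[OF tn zero \<open>0 < a\<close>, of _ c] in auto)
    moreover have "((\<lambda>\<delta>. f (1 * \<delta>) * (f (a + 3 * \<delta>) * f (c + (-2) * \<delta>) - f (1 * \<delta>) * f (a + c)))
        \<longlongrightarrow> L * (f a * f c - L * f (a + c))) (at_right 0)"
      using that by (intro tendsto_intros L_scale lim) auto
    moreover have "((\<lambda>\<delta>. f (a + 1 * \<delta>) * (f (3 * \<delta>) * f (c + (-2) * \<delta>) - f (1 * \<delta>) * f c))
        \<longlongrightarrow> f a * (L * f c - L * f c)) (at_right 0)"
      using that by (intro tendsto_intros L_scale lim) auto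
    ultimately have "L * (f a * f c - L * f (a + c)) \<le> f a * (L * f c - L * f c)"
      by (intro tendsto_le[of "at_right 0"]) auto
    then show ?thesis using \<open>0 < L\<close> by (simp add: mult_le_0_iff)
  qed
  have sub: "L * f (a + c) \<le> f a * f c" if "0 < a" "0 < c" "isCont f a" for a c
  proof -
    have "((\<lambda>\<delta>. f (a + \<delta>)) \<longlongrightarrow> f a) (at_right 0)"
      by (rule isCont_tendsto_compose[OF that(3)]) (auto intro!: tendsto_eq_intros)
    then have "((\<lambda>\<delta>. f (a + \<delta>) * f c) \<longlongrightarrow> f a * f c) (at_right 0)"
      by (intro tendsto_intros)
    moreover have "((\<lambda>\<delta>. f \<delta> * f (a + c)) \<longlongrightarrow> L * f (a + c)) (at_right 0)"
      by (intro tendsto_intros L)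
    moreover have "\<forall>\<^sub>F \<delta> in at_right 0. f \<delta> * f (a + c) \<le> f (a + \<delta>) * f c"
      using right[OF that(2)]
      by eventually_elim (use conc[of a "a + c"] \<open>0 < a\<close> in \<open>auto simp: add.commute\<close>)
    ultimately show ?thesis by (intro tendsto_le[of "at_right 0"]) auto
  qed
  \<comment> \<open>The point \<open>3 / 4 * s\<close> is interior to the support, while its double
    lies beyond \<open>s\<close>. Iterating \<open>super\<close> there shows that the support is
    unbounded.\<close>
  have grow: "0 < f (3 / 2 * s)" if "0 < s" "0 < f s" for s
  proof -
    have "isCont f (3 / 4 * s)" "0 < f (3 / 4 * s)"
      using cont_below[of "3 / 4 * s" s] pos_below[of "3 / 4 * s" s] that by auto
    then have "0 < L * f (3 / 4 * s + 3 / 4 * s)"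
      using super[of "3 / 4 * s" "3 / 4 * s"] that by (auto intro: less_le_trans[OF mult_pos_pos])
    also have "3 / 4 * s + 3 / 4 * s = 3 / 2 * s" by simp
    finally show ?thesis using \<open>0 < L\<close> by (simp add: zero_less_mult_iff)
  qed
  have pos_power: "0 < f ((3 / 2) ^ n * q)" for n
  proof (induction n)
    case (Suc n)
    then show ?case using grow[of "(3 / 2) ^ n * q"] \<open>0 < q\<close> by (simp add: mult.assoc)
  qed (use \<open>0 < f q\<close> in simp)
  have pos_cont: "0 < f x \<and> isCont f x" if "0 < x" for x
  proof -
    obtain n where "x / q < (3 / 2) ^ n"
      using real_arch_pow[of "3 / 2" "x / q"] by auto
    then have "x < (3 / 2) ^ n * q"
      using \<open>0 < q\<close> by (simp add: field_simps)
    then show ?thesis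
      using pos_below[OF that _ pos_power] cont_below[OF that _ pos_power] by blast
  qed
  have mult: "L * f (a + c) = f a * f c" if "0 < a" "0 < c" for a c
    using super[of a c] sub[of a c] pos_cont that by (intro antisym) auto
  define g where "g = (\<lambda>x. ln (f x / L))"
  have g: "g x = x * g 1" if "0 < x" for x
  proof (rule additive_on_pos_linear[OF _ _ that])
    fix a c :: real assume "0 < a" "0 < c"
    then have "f (a + c) / L = (f a / L) * (f c / L)"
      using mult[of a c] \<open>0 < L\<close> by (simp add: field_simps)
    moreover have "0 < f a / L" "0 < f c / L"
      using pos_cont \<open>0 < a\<close> \<open>0 < c\<close> \<open>0 < L\<close> by auto
    ultimately show "g (a + c) = g a + g c"
      unfolding g_def by (simp only: ln_mult_pos)
  next
    show "continuous_on {1..2} g"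
      unfolding g_def using pos_cont \<open>0 < L\<close>
      by (intro continuous_at_imp_continuous_on ballI continuous_intros) (auto simp: less_imp_neq[symmetric])
  qed
  have f_exp: "f x = L * exp (g 1 * x)" if "0 < x" for x
  proof -
    have "exp (g x) = f x / L"
      unfolding g_def using pos_cont[OF that] \<open>0 < L\<close> by simp
    then show ?thesis
      using g[OF that] \<open>0 < L\<close> by (simp add: mult.commute)
  qed
  show ?thesis
  proof (rule that[of L "f 0 / L" "g 1"])
    show "f 0 / L \<in> {0..1}"
      using f0 nonneg[of 0] \<open>0 < L\<close> by simp
    show "f x = L * (if x > 0 then exp (g 1 * x) else if x = 0 then f 0 / L else 0)" for x
      using f_exp[of x] zero[of x] \<open>0 < L\<close> by auto
  qed (fact \<open>0 < L\<close>)
qed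

text \<open>A discontinuity cannot lie between two points of the support, so the function vanishes
  on one side of it; a translation or reflection gives the normalised case. The sign
  \<open>u\<close> records the side.\<close>

lemma totally_nonneg_discontinuous_form:
  assumes tn: "totally_nonneg \<Lambda>" and meas: "\<Lambda> \<in> borel_measurable lebesgue"
    and two: "nonzero_at_two_points \<Lambda>" and disc: "\<not> continuous_on UNIV \<Lambda>"
  obtains L d u v k where "0 < L" "d \<in> {0..1}" "\<bar>u\<bar> = 1"
    "\<And>x. \<Lambda> x = L * (if u * x + v > 0 then exp (k * (u * x + v)) else if u * x + v = 0 then d else 0)"
proof -
  have nonneg: "0 \<le> \<Lambda> x" for x
    using tn by (rule totally_nonneg_ge_0)
  have conc: "\<Lambda> a * \<Lambda> b \<le> \<Lambda> (a + h) * \<Lambda> (b - h)" if "0 < h" "h < b - a" for a b h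
    using tn that by (rule totally_nonneg_log_concave)
  have cont: "isCont \<Lambda> x" if "p < x" "x < s" "0 < \<Lambda> p" "0 < \<Lambda> s" for p x s
  proof (rule log_concave_continuous[OF meas _ _ conc])
    \<comment> \<open>The divisor 8 keeps the interval of radius \<open>4 * r\<close> strictly
      between \<open>p\<close> and \<open>s\<close>.\<close>
    define r where "r = min (x - p) (s - x) / 8"
    have r: "0 < r" "8 * r \<le> x - p" "8 * r \<le> s - x" using that by (auto simp: r_def)
    then show "0 < r" by simp
    fix z assume "z \<in> {x - 4 * r..x + 4 * r}"
    then have z: "p < z" "z < s" using r unfolding atLeastAtMost_iff by linarith+
    have "0 < \<Lambda> p * \<Lambda> s" using that by simp
    also have "\<dots> \<le> \<Lambda> z * \<Lambda> (s - (z - p))"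
      using conc[of "z - p" s p] z by simp
    finally have "\<Lambda> z \<noteq> 0" by auto
    then show "0 < \<Lambda> z" using nonneg[of z] by simp
  qed
  obtain v where v: "\<not> isCont \<Lambda> v"
    using disc continuous_at_imp_continuous_on by blast
  obtain p0 q0 where pq: "p0 < q0" "0 < \<Lambda> p0" "0 < \<Lambda> q0"
  proof -
    obtain p q where "p \<noteq> q" "\<Lambda> p \<noteq> 0" "\<Lambda> q \<noteq> 0"
      using two unfolding nonzero_at_two_points_def by blast
    then show ?thesis
      using that[of p q] that[of q p] nonneg[of p] nonneg[of q] by linarith
  qed
  have "(\<forall>x<v. \<Lambda> x = 0) \<or> (\<forall>x>v. \<Lambda> x = 0)"
  proof (rule ccontr)
    assume "\<not> ?thesis"
    then obtain p s where "p < v" "v < s" "\<Lambda> p \<noteq> 0" "\<Lambda> s \<noteq> 0" by blast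
    with cont[of p v s] v nonneg[of p] nonneg[of s] show False by simp
  qed
  then consider "\<And>x. x < v \<Longrightarrow> \<Lambda> x = 0" | "\<And>x. x > v \<Longrightarrow> \<Lambda> x = 0"
    by blast
  then show ?thesis
  proof cases
    case 1
    \<comment> \<open>The smaller support point \<open>p0\<close> is not left of \<open>v\<close>,
      so \<open>q0\<close> is strictly to the right.\<close>
    have "v < q0"
      using 1[of p0] pq by (cases "p0 < v") auto
    have *: "isCont (\<lambda>x. \<Lambda> (v + x)) z \<longleftrightarrow> isCont \<Lambda> (v + z)" for z
      using isCont_o2[of "v + z" "\<lambda>y. y - v" "\<lambda>x. \<Lambda> (v + x)"] isCont_o2[of z "\<lambda>x. v + x" \<Lambda>]
      by auto
    obtain L k d where "0 < L" "d \<in> {0..1}"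
      and eq: "\<And>x. \<Lambda> (v + x) = L * (if x > 0 then exp (k * x) else if x = 0 then d else 0)"
    proof (rule one_sided_discontinuous_exp[OF totally_nonneg_translate[OF tn, of v]])
      show "\<Lambda> (v + x) = 0" if "x < 0" for x using 1 that by simp
      show "0 < q0 - v" "0 < \<Lambda> (v + (q0 - v))" using \<open>v < q0\<close> pq by auto
      show "isCont (\<lambda>x. \<Lambda> (v + x)) x" if "p < x" "x < s" "0 < \<Lambda> (v + p)" "0 < \<Lambda> (v + s)" for p x s
        using cont[of "v + p" "v + x" "v + s"] that by (simp add: *)
      show "\<not> isCont (\<lambda>x. \<Lambda> (v + x)) 0" using v by (simp add: *)
    qed (rule that)
    show ?thesis
    proof (rule that)
      show "\<Lambda> x = L * (if 1 * x + - v > 0 then exp (k * (1 * x + - v))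
          else if 1 * x + - v = 0 then d else 0)" for x
        using eq[of "x - v"] by simp
    qed (use \<open>0 < L\<close> \<open>d \<in> {0..1}\<close> in auto)
  next
    case 2
    have "p0 < v"
      using 2[of q0] pq by (cases "v < q0") auto
    have *: "isCont (\<lambda>x. \<Lambda> (v - x)) z \<longleftrightarrow> isCont \<Lambda> (v - z)" for z
      using isCont_o2[of "v - z" "\<lambda>y. v - y" "\<lambda>x. \<Lambda> (v - x)"] isCont_o2[of z "\<lambda>x. v - x" \<Lambda>]
      by auto
    obtain L k d where "0 < L" "d \<in> {0..1}"
      and eq: "\<And>x. \<Lambda> (v - x) = L * (if x > 0 then exp (k * x) else if x = 0 then d else 0)"
    proof (rule one_sided_discontinuous_exp[OF totally_nonneg_reflect[OF tn, of v]])
      show "\<Lambda> (v - x) = 0" if "x < 0" for x using 2 that by simp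
      show "0 < v - p0" "0 < \<Lambda> (v - (v - p0))" using \<open>p0 < v\<close> pq by auto
      show "isCont (\<lambda>x. \<Lambda> (v - x)) x" if "p < x" "x < s" "0 < \<Lambda> (v - p)" "0 < \<Lambda> (v - s)" for p x s
        using cont[of "v - s" "v - x" "v - p"] that by (simp add: *)
      show "\<not> isCont (\<lambda>x. \<Lambda> (v - x)) 0" using v by (simp add: *)
    qed (rule that)
    show ?thesis
    proof (rule that)
      show "\<Lambda> x = L * (if - 1 * x + v > 0 then exp (k * (- 1 * x + v))
          else if - 1 * x + v = 0 then d else 0)" for x
        using eq[of "v - x"] by simp
    qed (use \<open>0 < L\<close> \<open>d \<in> {0..1}\<close> in auto)
  qed
qed

section \<open>The converse direction and integrability\<close>

text \<open>After undoing the affine substitution, the one-sided limits at 0 are 0 and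
  \<open>C * exp b > 0\<close>, so no value \<open>d\<close> can repair the jump.\<close>

lemma discontinuous_exp_lambda_d:
  assumes "equal_upto_scale_origin \<Lambda> (\<lambda>x. exp (a * x + b) * lambda_d d x)"
  shows "\<not> continuous_on UNIV \<Lambda>"
proof
  assume cont: "continuous_on UNIV \<Lambda>"
  obtain C u v where C: "0 < C" "u \<noteq> 0"
    and eq: "\<And>x. \<Lambda> x = C * (exp (a * (u * x + v) + b) * lambda_d d (u * x + v))"
    using assms unfolding equal_upto_scale_origin_def by blast
  define g where "g = (\<lambda>y. \<Lambda> ((y - v) / u))"
  have g: "g y = C * (exp (a * y + b) * lambda_d d y)" for y
    using C by (simp add: g_def eq)
  have "continuous_on UNIV g"
    unfolding g_def by (rule continuous_on_compose2[OF cont]) (use C in \<open>auto intro!: continuous_intros\<close>)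
  then have lim: "(g \<longlongrightarrow> g 0) (at 0)"
    by (simp add: continuous_on_eq_continuous_at isCont_def)
  have "(g \<longlongrightarrow> 0) (at_left 0)"
    by (rule tendsto_eventually) (auto simp: eventually_at_filter g lambda_d_def intro!: always_eventually)
  moreover have "(g \<longlongrightarrow> g 0) (at_left 0)"
    using lim by (simp add: filterlim_at_split)
  ultimately have "g 0 = 0"
    using tendsto_unique trivial_limit_at_left_real by blast
  have "((\<lambda>y. C * (exp (a * y + b) * exp (- y))) \<longlongrightarrow> C * exp b) (at_right 0)"
    by (auto intro!: tendsto_eq_intros)
  moreover have "\<forall>\<^sub>F y in at_right 0. g y = C * (exp (a * y + b) * exp (- y))"
    by (auto simp: eventually_at_filter g lambda_d_def intro!: always_eventually)
  ultimately have "(g \<longlongrightarrow> C * exp b) (at_right 0)"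
    by (simp add: tendsto_cong)
  moreover have "(g \<longlongrightarrow> g 0) (at_right 0)"
    using lim by (simp add: filterlim_at_split)
  ultimately have "g 0 = C * exp b"
    using tendsto_unique trivial_limit_at_right_real by blast
  with \<open>g 0 = 0\<close> \<open>0 < C\<close> show False by simp
qed

text \<open>Each \<open>S n\<close> forces the integral to be at least \<open>n * L\<close>. This
  serves to exclude non-decaying exponentials.\<close>

lemma not_integrable_ge_on_large_sets:
  fixes f :: "'a :: euclidean_space \<Rightarrow> real"
  assumes "0 < L" "\<And>x. 0 \<le> f x" "\<And>n. real n \<le> measure lebesgue (S n)"
    "\<And>n. S n \<in> lmeasurable" "\<And>n x. x \<in> S n \<Longrightarrow> L \<le> f x"
  shows "\<not> integrable lebesgue f"
proof
  assume int: "integrable lebesgue f"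
  have "real n * L \<le> integral\<^sup>L lebesgue f" for n
  proof -
    have "real n * L \<le> measure lebesgue (S n) * L"
      using assms by (intro mult_right_mono) auto
    also have "\<dots> = (LINT x|lebesgue. indicat_real (S n) x * L)"
      using assms(4)[of n] by simp
    also have "\<dots> \<le> integral\<^sup>L lebesgue f"
    proof (rule integral_mono[OF _ int])
      show "integrable lebesgue (\<lambda>x. indicat_real (S n) x * L)"
        using fmeasurableD[OF assms(4)] fmeasurableD2[OF assms(4)]
        by (intro integrable_mult_left integrable_real_indicator) (auto simp: less_top)
    qed (use assms in \<open>auto simp: indicator_def\<close>)
    finally show ?thesis .
  qed
  moreover obtain n where "integral\<^sup>L lebesgue f < real n * L"
    using reals_Archimedean3[OF \<open>0 < L\<close>] by blast
  ultimately show False by (meson not_le)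
qed

section \<open>The two equivalences\<close>

theorem theorem3p8:
  "(\<forall>\<Lambda> :: real \<Rightarrow> real. polya_frequency \<Lambda> \<longrightarrow>
      (\<not> continuous_on UNIV \<Lambda> \<longleftrightarrow>
       (\<exists>d\<in>{0..1}. equal_upto_scale_origin \<Lambda> (lambda_d d)))) \<and>
   (\<forall>\<Lambda> :: real \<Rightarrow> real. totally_nonneg \<Lambda> \<longrightarrow>
      \<Lambda> \<in> borel_measurable lebesgue \<longrightarrow> nonzero_at_two_points \<Lambda> \<longrightarrow>
      (\<not> continuous_on UNIV \<Lambda> \<longleftrightarrow>
       (\<exists>d\<in>{0..1}. \<exists>a b :: real.
          equal_upto_scale_origin \<Lambda> (\<lambda>x. exp (a * x + b) * lambda_d d x))))"
proof (intro conjI allI impI iffI)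
  fix \<Lambda> :: "real \<Rightarrow> real"
  assume pf: "polya_frequency \<Lambda>" and disc: "\<not> continuous_on UNIV \<Lambda>"
  then have tn: "totally_nonneg \<Lambda>" and int: "integrable lebesgue \<Lambda>"
    and two: "nonzero_at_two_points \<Lambda>"
    by (auto simp: polya_frequency_def)
  obtain L d u v k where L: "0 < L" "d \<in> {0..1}" "\<bar>u\<bar> = 1"
    and eq: "\<And>x. \<Lambda> x = L * (if u * x + v > 0 then exp (k * (u * x + v))
      else if u * x + v = 0 then d else 0)"
    by (rule totally_nonneg_discontinuous_form[OF tn borel_measurable_integrable[OF int] two disc])
      (rule that)
  have u: "u = 1 \<or> u = -1" using L(3) by linarith
  have "k < 0"
  proof (rule ccontr)
    assume "\<not> k < 0"
    \<comment> \<open>Intervals of length \<open>n\<close> in the half-line where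
      \<open>u * x + v \<ge> 1\<close>, away from the endpoint with its value \<open>d\<close>;
      there the exponential is at least 1 when \<open>k \<ge> 0\<close>.\<close>
    define S where "S = (\<lambda>n::nat. if u = 1 then {1 - v..1 - v + n} else {v - 1 - n..v - 1})"
    have "\<not> integrable lebesgue \<Lambda>"
    proof (rule not_integrable_ge_on_large_sets[OF L(1), of _ S])
      show "0 \<le> \<Lambda> x" for x using tn by (rule totally_nonneg_ge_0)
      show "real n \<le> measure lebesgue (S n)" "S n \<in> lmeasurable" for n
        by (auto simp: S_def)
      show "L \<le> \<Lambda> x" if "x \<in> S n" for n x
      proof -
        have "0 < u * x + v" using u that by (auto simp: S_def split: if_splits)
        moreover from this have "0 \<le> k * (u * x + v)" using \<open>\<not> k < 0\<close> by simp
        ultimately show ?thesis using L(1) by (simp add: eq)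
      qed
    qed
    with int show False by simp
  qed
  \<comment> \<open>The factor \<open>-k > 0\<close> normalises the decay rate to 1 and preserves
    the sign of \<open>u * x + v\<close>.\<close>
  then have "\<Lambda> x = L * lambda_d d (- k * u * x + - k * v)" for x
  proof -
    have "- k * u * x + - k * v = - k * (u * x + v)" by (simp add: algebra_simps)
    then show ?thesis
      using \<open>k < 0\<close> unfolding eq lambda_d_def
      by (auto simp: mult_less_0_iff zero_less_mult_iff simp del: minus_mult_left[symmetric])
  qed
  moreover have "- k * u \<noteq> 0" using \<open>k < 0\<close> u by auto
  ultimately have "equal_upto_scale_origin \<Lambda> (lambda_d d)"
    unfolding equal_upto_scale_origin_def using L(1) by blast
  with L(2) show "\<exists>d\<in>{0..1}. equal_upto_scale_origin \<Lambda> (lambda_d d)" by blast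
next
  fix \<Lambda> :: "real \<Rightarrow> real"
  assume "\<exists>d\<in>{0..1}. equal_upto_scale_origin \<Lambda> (lambda_d d)"
  then obtain d where "equal_upto_scale_origin \<Lambda> (lambda_d d)" by blast
  then show "\<not> continuous_on UNIV \<Lambda>"
    using discontinuous_exp_lambda_d[of \<Lambda> 0 0 d] by simp
next
  fix \<Lambda> :: "real \<Rightarrow> real"
  assume asm: "totally_nonneg \<Lambda>" "\<Lambda> \<in> borel_measurable lebesgue" "nonzero_at_two_points \<Lambda>"
    "\<not> continuous_on UNIV \<Lambda>"
  obtain L d u v k where L: "0 < L" "d \<in> {0..1}" "\<bar>u\<bar> = 1"
    and eq: "\<And>x. \<Lambda> x = L * (if u * x + v > 0 then exp (k * (u * x + v))
      else if u * x + v = 0 then d else 0)"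
    by (rule totally_nonneg_discontinuous_form[OF asm]) (rule that)
  \<comment> \<open>The \<open>+ 1\<close> cancels the decay built into \<open>lambda_d\<close>; the
    constant sits in \<open>L\<close>, so \<open>b = 0\<close>.\<close>
  have "\<Lambda> x = L * (exp ((k + 1) * (u * x + v) + 0) * lambda_d d (u * x + v))" for x
  proof -
    have "L * (if y > 0 then exp (k * y) else if y = 0 then d else 0)
        = L * (exp ((k + 1) * y + 0) * lambda_d d y)" for y
      by (simp add: lambda_d_def exp_add[symmetric] algebra_simps)
    then show ?thesis unfolding eq .
  qed
  moreover have "u \<noteq> 0" using L(3) by auto
  ultimately have "equal_upto_scale_origin \<Lambda> (\<lambda>x. exp ((k + 1) * x + 0) * lambda_d d x)"
    unfolding equal_upto_scale_origin_def using L(1) by blast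
  with L(2) show "\<exists>d\<in>{0..1}. \<exists>a b. equal_upto_scale_origin \<Lambda> (\<lambda>x. exp (a * x + b) * lambda_d d x)"
    by blast
next
  fix \<Lambda> :: "real \<Rightarrow> real"
  assume "\<exists>d\<in>{0..1}. \<exists>a b. equal_upto_scale_origin \<Lambda> (\<lambda>x. exp (a * x + b) * lambda_d d x)"
  then show "\<not> continuous_on UNIV \<Lambda>"
    using discontinuous_exp_lambda_d by blast
qed

end
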